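(* A Frenet curve $\bar\gamma:I\subset\mathbb{R}\to\mathbb{C}P^n$ parametrized by arc-length with $\bar\tau_{12}=\pm1$ is proper-biharmonic if and only if it is a circle with $\bar k_1=2$.
   Context: $\mathbb{C}P^n$ carries the Fubini-Study metric $\langle\cdot,\cdot\rangle$ of constant holomorphic sectional curvature $4$, with complex structure $\bar J$ and Levi-Civita connection $\bar\nabla$. A curve $\bar\gamma:I\subset\mathbb{R}\to\mathbb{C}P^n$ parametrized by arc-length is a Frenet curve of osculating order $d$ ($1\le d\le 2n$) if there exist $d$ orthonormal vector fields $\bar E_1=\bar\gamma',\dots,\bar E_d$ along $\bar\gamma$ such that $\bar\nabla_{\bar E_1}\bar E_1=\bar k_1\bar E_2$, $\bar\nabla_{\bar E_1}\bar E_i=-\bar k_{i-1}\bar E_{i-1}+\bar k_i\bar E_{i+1}$ for $2\le i\le d-1$, $\bar\nabla_{\bar E_1}\bar E_d=-\bar k_{d-1}\bar E_{d-1}$, where $\bar k_1,\dots,\bar k_{d-1}$ are positive functions (the curvatures). It is a helix of order $d$ if all $\bar k_i$ are positive constants; a helix of order $2$ is called a circle. The complex torsions are $\bar\tau_{ij}=\langle\bar E_i,\bar J\bar E_j\rangle$, $1\le i<j\le d$. A map $\varphi:(M,g)\to(N,h)$ is biharmonic if $\tau_2(\varphi)=-\Delta^{\varphi}\tau(\varphi)-\operatorname{trace}R^N(d\varphi,\tau(\varphi))d\varphi=0$, where $\tau(\varphi)=\operatorname{trace}\nabla d\varphi$, $\Delta^\varphi=-\operatorname{trace}(\nabla^\varphi)^2$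 and $R^N(X,Y)Z=\nabla_X\nabla_YZ-\nabla_Y\nabla_XZ-\nabla_{[X,Y]}Z$; it is proper-biharmonic if moreover it is not harmonic. A curve is proper-biharmonic if it is so as a map from the interval $I$. *)

theory Defs
  imports "HOL-Analysis.Analysis"
begin

text \<open>
  Complex projective \<open>n\<close>-space is the set of complex lines in \<open>C^(n+1)\<close>, where \<open>n\<close> is
  \<open>CARD('n)\<close> and homogeneous coordinates are indexed by \<open>'n option\<close>.
\<close>

section \<open>Riemannian geometry in one coordinate patch\<close>

text \<open>
  \<open>g x u v\<close> is the metric at the point \<open>x\<close> of the patch.  The vector \<open>christoffel g x u v\<close> is
  the value at \<open>x\<close> of \<open>\<nabla>\<^sub>u v\<close> for the constant fields \<open>u\<close>, \<open>v\<close>, where \<open>\<nabla>\<close> is the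
  Levi-Civita connection: the condition is the Koszul formula (brackets of constant fields vanish).
\<close>

definition christoffel ::
    "('a::euclidean_space \<Rightarrow> 'a \<Rightarrow> 'a \<Rightarrow> real) \<Rightarrow> 'a \<Rightarrow> 'a \<Rightarrow> 'a \<Rightarrow> 'a" where
  "christoffel g x u v = (THE y. \<forall>w. 2 * g x y w =
       frechet_derivative (\<lambda>x. g x v w) (at x) u
     + frechet_derivative (\<lambda>x. g x u w) (at x) v
     - frechet_derivative (\<lambda>x. g x u v) (at x) w)"

text \<open>
  \<open>R(u,v)w = \<nabla>\<^sub>u\<nabla>\<^sub>v w - \<nabla>\<^sub>v\<nabla>\<^sub>u w\<close> for constant fields.
\<close>

definition local_curvature ::
    "('a::euclidean_space \<Rightarrow> 'a \<Rightarrow> 'a \<Rightarrow> real) \<Rightarrow> 'a \<Rightarrow> 'a \<Rightarrow> 'a \<Rightarrow> 'a \<Rightarrow> 'a" where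
  "local_curvature g x u v w =
       (frechet_derivative (\<lambda>x. christoffel g x v w) (at x) u
          + christoffel g x u (christoffel g x v w))
     - (frechet_derivative (\<lambda>x. christoffel g x u w) (at x) v
          + christoffel g x v (christoffel g x u w))"


section \<open>Complex projective space\<close>

definition hprod :: "complex^'m::finite \<Rightarrow> complex^'m \<Rightarrow> complex" where
  "hprod v w = (\<Sum>k\<in>UNIV. v $ k * cnj (w $ k))"

definition CP :: "(complex^('n::finite option)) set set" where
  "CP = {vec.span {z} | z. z \<noteq> 0}"

text \<open>
  The tangent space at the line \<open>p\<close> is \<open>Hom(p, p\<^sup>\<bottom>)\<close>, a homomorphism being extended by \<open>0\<close> to
  \<open>p\<^sup>\<bottom>\<close> and written as a matrix.
\<close>

definition tangent_space ::
    "(complex^('n::finite option)) set \<Rightarrow> (complex^('n option)^('n option)) set" where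
  "tangent_space p = {A.
      (\<forall>v. (\<forall>z\<in>p. hprod v z = 0) \<longrightarrow> A *v v = 0) \<and>
      (\<forall>v. \<forall>z\<in>p. hprod (A *v v) z = 0)}"

text \<open>
  The differential at \<open>z \<noteq> 0\<close> of the projection from \<open>C^(n+1) - {0}\<close> to projective space: it
  sends \<open>v\<close> to the homomorphism taking \<open>z\<close> to the component of \<open>v\<close> orthogonal to \<open>z\<close>.
\<close>

definition dproj ::
    "complex^('n::finite option) \<Rightarrow> complex^('n option) \<Rightarrow> complex^('n option)^('n option)" where
  "dproj z v = (\<chi> k l. (v $ k - hprod v z / hprod z z * z $ k) * cnj (z $ l) / hprod z z)"

text \<open>
  The Fubini-Study metric \<open>Re tr (A B\<^sup>*)\<close> on \<open>Hom(p, p\<^sup>\<bottom>)\<close>.  For a unit vector \<open>z\<close> and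
  \<open>v\<close> orthogonal to \<open>z\<close> the norm of \<open>dproj z v\<close> is that of \<open>v\<close>, so the unit sphere
  submerses isometrically onto projective space; this is the normalisation with constant
  holomorphic sectional curvature 4.
\<close>

definition fubini_study ::
    "complex^('n::finite option)^('n option) \<Rightarrow> complex^('n option)^('n option) \<Rightarrow> real" where
  "fubini_study A B = (\<Sum>k\<in>UNIV. \<Sum>l\<in>UNIV. Re (A $ k $ l * cnj (B $ k $ l)))"

definition cstruct ::
    "complex^('n::finite option)^('n option) \<Rightarrow> complex^('n option)^('n option)" where
  "cstruct A = (\<chi> k l. \<i> * A $ k $ l)"


subsection \<open>Affine charts\<close>

text \<open>
  \<open>affine_emb i c w\<close> has \<open>c\<close> in slot \<open>i\<close> and the entries of \<open>w\<close> in the remaining slots (the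
  entry that slot \<open>i\<close> displaces goes to slot \<open>None\<close>).  The chart \<open>i\<close> is inverse to
  \<open>w \<mapsto> [affine_emb i 1 w]\<close>, and \<open>u \<mapsto> affine_emb i 0 u\<close> is the differential of
  \<open>affine_emb i 1\<close>.
\<close>

definition affine_emb ::
    "'n option \<Rightarrow> complex \<Rightarrow> complex^'n::finite \<Rightarrow> complex^('n option)" where
  "affine_emb i c w = (\<chi> k. if k = i then c
       else (case k of None \<Rightarrow> w $ the i | Some j \<Rightarrow> w $ j))"

definition chart_dom :: "'n option \<Rightarrow> (complex^('n::finite option)) set set" where
  "chart_dom i = {p \<in> CP. \<exists>z\<in>p. z $ i \<noteq> 0}"

definition chart :: "'n option \<Rightarrow> (complex^('n::finite option)) set \<Rightarrow> complex^'n" where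
  "chart i p = (THE w. affine_emb i 1 w \<in> p)"

definition chart_vector ::
    "'n option \<Rightarrow> complex^'n \<Rightarrow> complex^'n \<Rightarrow> complex^('n::finite option)^('n option)" where
  "chart_vector i w u = dproj (affine_emb i 1 w) (affine_emb i 0 u)"

definition components ::
    "'n option \<Rightarrow> (complex^('n::finite option)) set \<Rightarrow>
     complex^('n option)^('n option) \<Rightarrow> complex^'n" where
  "components i p A = (THE u. chart_vector i (chart i p) u = A)"

definition chart_metric ::
    "'n option \<Rightarrow> complex^'n::finite \<Rightarrow> complex^'n \<Rightarrow> complex^'n \<Rightarrow> real" where
  "chart_metric i w u v = fubini_study (chart_vector i w u) (chart_vector i w v)"

text \<open>
  The notions below are computed in some chart around the point; being tensorial, they do not
  depend on which one is taken.
\<close>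

definition chart_at :: "(complex^('n::finite option)) set \<Rightarrow> 'n option" where
  "chart_at p = (SOME i. p \<in> chart_dom i)"

definition curvature_tensor ::
    "(complex^('n::finite option)) set \<Rightarrow> complex^('n option)^('n option) \<Rightarrow>
     complex^('n option)^('n option) \<Rightarrow> complex^('n option)^('n option) \<Rightarrow>
     complex^('n option)^('n option)" where
  "curvature_tensor p A B C = (let i = chart_at p in
     chart_vector i (chart i p)
       (local_curvature (chart_metric i) (chart i p)
          (components i p A) (components i p B) (components i p C)))"


section \<open>Harmonic and biharmonic maps into projective space\<close>

text \<open>
  The maps are smooth maps from a subset \<open>S\<close> of a Euclidean space with the flat metric; \<open>S\<close> is
  an open set or a nondegenerate interval of the real line.  Derivatives are taken within \<open>S\<close>,
  hence one-sided at endpoints.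
\<close>

definition differential ::
    "'b::euclidean_space set \<Rightarrow> ('b \<Rightarrow> (complex^('n::finite option)) set) \<Rightarrow> 'b \<Rightarrow> 'b \<Rightarrow>
     complex^('n option)^('n option)" where
  "differential S \<phi> x b = (let i = chart_at (\<phi> x) in
     chart_vector i (chart i (\<phi> x))
       (frechet_derivative (\<lambda>y. chart i (\<phi> y)) (at x within S) b))"

text \<open>
  The pull-back connection: \<open>pullback_nabla S \<phi> b V x\<close> is the covariant derivative at \<open>x\<close>,
  in the direction \<open>b\<close>, of the vector field \<open>V\<close> along \<open>\<phi>\<close>.
\<close>

definition pullback_nabla ::
    "'b::euclidean_space set \<Rightarrow> ('b \<Rightarrow> (complex^('n::finite option)) set) \<Rightarrow> 'b \<Rightarrow>
     ('b \<Rightarrow> complex^('n option)^('n option)) \<Rightarrow> 'b \<Rightarrow> complex^('n option)^('n option)" where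
  "pullback_nabla S \<phi> b V x = (let i = chart_at (\<phi> x) in
     chart_vector i (chart i (\<phi> x))
       (frechet_derivative (\<lambda>y. components i (\<phi> y) (V y)) (at x within S) b
        + christoffel (chart_metric i) (chart i (\<phi> x))
            (frechet_derivative (\<lambda>y. chart i (\<phi> y)) (at x within S) b)
            (components i (\<phi> x) (V x))))"

text \<open>
  Traces are taken over the orthonormal basis \<open>Basis\<close>, whose elements are parallel fields on the
  domain; so \<open>(\<nabla>d\<phi>)(b,b) = \<nabla>\<^sub>b (d\<phi> b)\<close> and \<open>(\<nabla>\<^sup>2V)(b,b) = \<nabla>\<^sub>b \<nabla>\<^sub>b V\<close>.
\<close>

definition tension_field ::
    "'b::euclidean_space set \<Rightarrow> ('b \<Rightarrow> (complex^('n::finite option)) set) \<Rightarrow> 'b \<Rightarrow>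
     complex^('n option)^('n option)" where
  "tension_field S \<phi> x = (\<Sum>b\<in>Basis. pullback_nabla S \<phi> b (\<lambda>y. differential S \<phi> y b) x)"

definition rough_laplacian ::
    "'b::euclidean_space set \<Rightarrow> ('b \<Rightarrow> (complex^('n::finite option)) set) \<Rightarrow>
     ('b \<Rightarrow> complex^('n option)^('n option)) \<Rightarrow> 'b \<Rightarrow> complex^('n option)^('n option)" where
  "rough_laplacian S \<phi> V x =
     - (\<Sum>b\<in>Basis. pullback_nabla S \<phi> b (pullback_nabla S \<phi> b V) x)"

definition bitension_field ::
    "'b::euclidean_space set \<Rightarrow> ('b \<Rightarrow> (complex^('n::finite option)) set) \<Rightarrow> 'b \<Rightarrow>
     complex^('n option)^('n option)" where
  "bitension_field S \<phi> x =
     - rough_laplacian S \<phi> (tension_field S \<phi>) x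
     - (\<Sum>b\<in>Basis. curvature_tensor (\<phi> x)
           (differential S \<phi> x b) (tension_field S \<phi> x) (differential S \<phi> x b))"

definition harmonic_map ::
    "'b::euclidean_space set \<Rightarrow> ('b \<Rightarrow> (complex^('n::finite option)) set) \<Rightarrow> bool" where
  "harmonic_map S \<phi> \<longleftrightarrow> (\<forall>x\<in>S. tension_field S \<phi> x = 0)"

definition biharmonic_map ::
    "'b::euclidean_space set \<Rightarrow> ('b \<Rightarrow> (complex^('n::finite option)) set) \<Rightarrow> bool" where
  "biharmonic_map S \<phi> \<longleftrightarrow> (\<forall>x\<in>S. bitension_field S \<phi> x = 0)"

definition proper_biharmonic_map ::
    "'b::euclidean_space set \<Rightarrow> ('b \<Rightarrow> (complex^('n::finite option)) set) \<Rightarrow> bool" where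
  "proper_biharmonic_map S \<phi> \<longleftrightarrow> biharmonic_map S \<phi> \<and> \<not> harmonic_map S \<phi>"


section \<open>Frenet curves\<close>

text \<open>Infinite differentiability on \<open>I\<close>; \<open>F m\<close> is the \<open>m\<close>-th derivative of \<open>f\<close>.\<close>

definition smooth_fun_on :: "real set \<Rightarrow> (real \<Rightarrow> 'a::real_normed_vector) \<Rightarrow> bool" where
  "smooth_fun_on I f \<longleftrightarrow> (\<exists>F :: nat \<Rightarrow> real \<Rightarrow> 'a.
     (\<forall>t\<in>I. F 0 t = f t) \<and>
     (\<forall>m. \<forall>t\<in>I. (F m has_vector_derivative F (Suc m) t) (at t within I)))"

definition smooth_curve ::
    "real set \<Rightarrow> (real \<Rightarrow> (complex^('n::finite option)) set) \<Rightarrow> bool" where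
  "smooth_curve I \<gamma> \<longleftrightarrow> (\<forall>t\<in>I. \<gamma> t \<in> CP) \<and>
     (\<forall>i. openin (top_of_set I) {t\<in>I. \<gamma> t \<in> chart_dom i} \<and>
          smooth_fun_on {t\<in>I. \<gamma> t \<in> chart_dom i} (\<lambda>t. chart i (\<gamma> t)))"

text \<open>
  The tangent bundle is a smooth subbundle of the trivial bundle of matrices, so smoothness of a
  section can be tested on the matrix entries.
\<close>

definition smooth_field_along ::
    "real set \<Rightarrow> (real \<Rightarrow> (complex^('n::finite option)) set) \<Rightarrow>
     (real \<Rightarrow> complex^('n option)^('n option)) \<Rightarrow> bool" where
  "smooth_field_along I \<gamma> X \<longleftrightarrow> (\<forall>t\<in>I. X t \<in> tangent_space (\<gamma> t)) \<and> smooth_fun_on I X"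

text \<open>
  \<open>E i\<close> for \<open>1 \<le> i \<le> d\<close> is the Frenet frame and \<open>k i\<close> for \<open>1 \<le> i < d\<close> the
  curvatures; \<open>E\<close> and \<open>k\<close> are irrelevant at other indices.
\<close>

definition frenet_curve ::
    "real set \<Rightarrow> (real \<Rightarrow> (complex^('n::finite option)) set) \<Rightarrow> nat \<Rightarrow>
     (nat \<Rightarrow> real \<Rightarrow> complex^('n option)^('n option)) \<Rightarrow> (nat \<Rightarrow> real \<Rightarrow> real) \<Rightarrow> bool" where
  "frenet_curve I \<gamma> d E k \<longleftrightarrow>
     is_interval I \<and> interior I \<noteq> {} \<and> smooth_curve I \<gamma> \<and>
     1 \<le> d \<and> d \<le> 2 * CARD('n) \<and>
     (\<forall>i\<in>{1..d}. smooth_field_along I \<gamma> (E i)) \<and>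
     (\<forall>t\<in>I. \<forall>i\<in>{1..d}. \<forall>j\<in>{1..d}. fubini_study (E i t) (E j t) = (if i = j then 1 else 0)) \<and>
     (\<forall>t\<in>I. E 1 t = differential I \<gamma> t 1) \<and>
     (\<forall>i\<in>{1..<d}. \<forall>t\<in>I. k i t > 0) \<and>
     (\<forall>i\<in>{1..d}. \<forall>t\<in>I. pullback_nabla I \<gamma> 1 (E i) t =
          (if 1 < i then - (k (i - 1) t *\<^sub>R E (i - 1) t) else 0)
        + (if i < d then k i t *\<^sub>R E (i + 1) t else 0))"

definition helix ::
    "real set \<Rightarrow> (real \<Rightarrow> (complex^('n::finite option)) set) \<Rightarrow> nat \<Rightarrow>
     (nat \<Rightarrow> real \<Rightarrow> complex^('n option)^('n option)) \<Rightarrow> (nat \<Rightarrow> real \<Rightarrow> real) \<Rightarrow> bool" where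
  "helix I \<gamma> d E k \<longleftrightarrow> frenet_curve I \<gamma> d E k \<and>
     (\<forall>i\<in>{1..<d}. \<exists>c>0. \<forall>t\<in>I. k i t = c)"

definition circle ::
    "real set \<Rightarrow> (real \<Rightarrow> (complex^('n::finite option)) set) \<Rightarrow>
     (nat \<Rightarrow> real \<Rightarrow> complex^('n option)^('n option)) \<Rightarrow> (nat \<Rightarrow> real \<Rightarrow> real) \<Rightarrow> bool" where
  "circle I \<gamma> E k \<longleftrightarrow> helix I \<gamma> 2 E k"

definition complex_torsion ::
    "(nat \<Rightarrow> real \<Rightarrow> complex^('n::finite option)^('n option)) \<Rightarrow> nat \<Rightarrow> nat \<Rightarrow> real \<Rightarrow> real" where
  "complex_torsion E i j t = fubini_study (E i t) (cstruct (E j t))"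

end

theory Submission imports Defs begin

text \<open>
  Let \<open>s = \<plusminus>1\<close> be the value of the complex torsion.  Equality in the Cauchy-Schwarz inequality turns
  \<open>\<langle>E\<^sub>1, J E\<^sub>2\<rangle> = s\<close> into \<open>E\<^sub>1 = s J E\<^sub>2\<close>, and by continuity \<open>s\<close> is constant along the
  curve.  The complex structure is parallel, so \<open>\<nabla>E\<^sub>2 = - s J \<nabla>E\<^sub>1 = - k\<^sub>1 E\<^sub>1\<close>; since
  this has no component along a third frame vector, the osculating order is 2.  The tension field is \<open>k\<^sub>1 E\<^sub>2\<close>.
  Differentiating it twice with the Frenet equations and inserting
  \<open>R(E\<^sub>1, J E\<^sub>1) E\<^sub>1 = - 4 J E\<^sub>1\<close>, which expresses that the holomorphic sectional curvature is 4,
  gives the bitension field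
  \<open>- 3 k\<^sub>1 k\<^sub>1' E\<^sub>1 + (k\<^sub>1'' - k\<^sub>1\<^sup>3 + 4 k\<^sub>1) E\<^sub>2\<close>.
  Since \<open>k\<^sub>1 > 0\<close>, it vanishes exactly if \<open>k\<^sub>1\<close> is constant with \<open>k\<^sub>1\<^sup>2 = 4\<close>, that is, if
  \<open>k\<^sub>1 = 2\<close>; and the tension field is never zero.

  The geometry of projective space enters through two facts.  The first, \<open>pullback_nabla_eq\<close>,
  says that the covariant derivative of a field of homomorphisms \<open>V(t) \<in> Hom(p, p\<^sup>\<bottom>)\<close> is the orthogonal
  projection \<open>(1 - P) V' P\<close> of its ordinary derivative as a matrix-valued function, where \<open>P(t)\<close> is
  the orthogonal projection to the line \<open>p(t)\<close>.  It follows from the Christoffel map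
  \<open>\<Gamma>\<^sub>x(u,v) = - (\<langle>u,x\<rangle> v + \<langle>v,x\<rangle> u) / (1 + \<bar>x\<bar>\<^sup>2)\<close>
  of the affine charts, found in \<open>christoffel_chart_metric\<close>.  From the projection formula the Leibniz rule, the
  parallelism of the complex structure and the differentiability of the curvature \<open>k\<^sub>1\<close> are
  immediate.  The second, \<open>curvature_tensor_J\<close>, is the value of the curvature tensor on a complex
  line.
\<close>

section \<open>Hermitian linear algebra\<close>

definition perp :: "complex^'m::finite \<Rightarrow> complex^'m \<Rightarrow> complex^'m" where
  "perp z v = v - (hprod v z / hprod z z) *s z"

lemma hprod_simps:
  "hprod (u + v) w = hprod u w + hprod v w"
  "hprod u (v + w) = hprod u v + hprod u w"
  "hprod (u - v) w = hprod u w - hprod v w"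
  "hprod u (v - w) = hprod u v - hprod u w"
  "hprod (- u) w = - hprod u w"
  "hprod (c *s u) w = c * hprod u w"
  "hprod u (c *s w) = cnj c * hprod u w"
  "hprod (r *\<^sub>R u) w = r *\<^sub>R hprod u w"
  "hprod u (r *\<^sub>R w) = r *\<^sub>R hprod u w"
  "hprod 0 w = 0"
  "hprod u 0 = 0"
  by (simp_all add: hprod_def algebra_simps sum.distrib sum_subtractf sum_negf sum_distrib_left
      scaleR_right.sum)

lemma cnj_hprod: "cnj (hprod u v) = hprod v u"
  by (simp add: hprod_def mult.commute)

lemma hprod_self: "hprod u u = of_real ((norm u)\<^sup>2)"
  by (simp add: hprod_def complex_norm_square[symmetric] norm_vec_def L2_set_def sum_nonneg)

lemma hprod_self_eq_0: "hprod u u = 0 \<longleftrightarrow> u = 0"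
  by (simp add: hprod_self)

lemma bounded_bilinear_hprod: "bounded_bilinear hprod"
proof -
  have "bilinear (hprod :: complex^'m::finite \<Rightarrow> _)"
    unfolding bilinear_def by (auto intro!: linearI simp: hprod_simps)
  then show ?thesis by (simp add: bilinear_conv_bounded_bilinear)
qed

lemma scaleR_eq_scale: "r *\<^sub>R u = complex_of_real r *s u"
  unfolding vec_eq_iff by (simp add: scaleR_conv_of_real[where 'a=complex])

lemma bounded_bilinear_scale: "bounded_bilinear ((*s) :: complex \<Rightarrow> complex^'m::finite \<Rightarrow> _)"
proof -
  have "bilinear ((*s) :: complex \<Rightarrow> complex^'m::finite \<Rightarrow> _)"
    unfolding bilinear_def by (auto intro!: linearI simp: vec_eq_iff algebra_simps)
  then show ?thesis by (simp add: bilinear_conv_bounded_bilinear)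
qed

lemma bounded_bilinear_mv: "bounded_bilinear ((*v) :: complex^'m::finite^'m \<Rightarrow> complex^'m \<Rightarrow> _)"
proof -
  have "bilinear ((*v) :: complex^'m::finite^'m \<Rightarrow> complex^'m \<Rightarrow> _)"
    unfolding bilinear_def by (auto intro!: linearI simp: vec_eq_iff algebra_simps matrix_vector_mult_def sum.distrib scaleR_right.sum)
  then show ?thesis by (simp add: bilinear_conv_bounded_bilinear)
qed

lemma dproj_perp: "dproj z v = (\<chi> k l. perp z v $ k * cnj (z $ l) / hprod z z)"
  by (simp add: dproj_def perp_def)

lemma perp_linear:
  "perp z (u + v) = perp z u + perp z v"
  "perp z (u - v) = perp z u - perp z v"
  "perp z (c *s u) = c *s perp z u"
  by (simp_all add: perp_def vec_eq_iff hprod_simps algebra_simps add_divide_distrib diff_divide_distrib)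

lemma perp_self: "perp z z = 0"
  using hprod_self_eq_0[of z] by (cases "z = 0") (simp_all add: perp_def vec_eq_iff)

lemma hprod_perp: "hprod (perp z v) z = 0"
  using hprod_self_eq_0[of z] by (cases "z = 0") (simp_all add: perp_def hprod_simps)

lemma dproj_linear:
  "dproj z (u + v) = dproj z u + dproj z v"
  "dproj z (u - v) = dproj z u - dproj z v"
  "dproj z (r *\<^sub>R u) = r *\<^sub>R dproj z u"
  "dproj z (\<i> *s u) = cstruct (dproj z u)"
  by (simp_all add: dproj_perp perp_linear scaleR_eq_scale vec_eq_iff cstruct_def algebra_simps add_divide_distrib diff_divide_distrib scaleR_conv_of_real[where 'a=complex])

lemma dproj_self: "dproj z (c *s z) = 0"
  by (simp add: dproj_perp perp_linear perp_self vec_eq_iff)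

text \<open>
  The homomorphism \<open>dproj z u\<close> has rank one: it factors through the orthogonal projection to the line
  of \<open>z\<close>.
\<close>

lemma dproj_mv: "dproj z u *v v = (hprod v z / hprod z z) *s perp z u"
  by (simp add: dproj_perp vec_eq_iff matrix_vector_mult_def hprod_def[of v] sum_divide_distrib sum_distrib_left sum_distrib_right mult_ac)

lemma dproj_mv_self: "z \<noteq> 0 \<Longrightarrow> dproj z u *v z = perp z u"
  using hprod_self_eq_0[of z] by (simp add: dproj_mv)

lemma dproj_eq_iff: "z \<noteq> 0 \<Longrightarrow> dproj z u = dproj z v \<longleftrightarrow> perp z u = perp z v"
  by (metis dproj_mv_self dproj_perp)

lemma fubini_study_dproj:
  "fubini_study M (dproj z b) = Re (hprod (M *v z) (perp z b) / hprod z z)"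
proof -
  have c: "cnj (hprod z z) = hprod z z" by (rule cnj_hprod)
  have "(\<Sum>k\<in>UNIV. \<Sum>l\<in>UNIV. M $ k $ l * cnj (dproj z b $ k $ l)) = hprod (M *v z) (perp z b) / hprod z z"
    unfolding hprod_def[of "M *v z"]
    by (simp add: c dproj_perp matrix_vector_mult_def sum_divide_distrib sum_distrib_left sum_distrib_right mult_ac)
  then show ?thesis
    unfolding fubini_study_def Re_sum[symmetric] by (simp only:)
qed

lemma fubini_study_inner: "fubini_study A B = A \<bullet> B"
  by (simp add: fubini_study_def inner_vec_def inner_complex_def)

lemma hprod_perp2: "hprod (perp z u) (perp z v) = hprod u (perp z v)"
  by (simp add: perp_def[of _ u] hprod_simps) (metis cnj_hprod complex_cnj_zero hprod_perp)

lemma fubini_study_dproj_left: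
  assumes "z \<noteq> 0" shows "fubini_study (dproj z (M *v z)) (dproj z b) = fubini_study M (dproj z b)"
  by (simp add: fubini_study_dproj dproj_mv_self[OF assms] hprod_perp2)

lemma cstruct_mv: "cstruct A *v v = \<i> *s (A *v v)"
  by (simp add: cstruct_def vec_eq_iff matrix_vector_mult_def sum_distrib_left mult.assoc)

lemma bounded_linear_cstruct: "bounded_linear cstruct"
  by (auto intro!: linear_conv_bounded_linear[THEN iffD1] linearI simp: cstruct_def vec_eq_iff algebra_simps)

lemma cstruct_cstruct: "cstruct (cstruct A) = - A"
  by (simp add: cstruct_def vec_eq_iff mult.assoc[symmetric])

lemma cstruct_inner: "cstruct A \<bullet> cstruct B = A \<bullet> B"
  by (simp add: cstruct_def inner_vec_def inner_complex_def add.commute)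

text \<open>
  An element of \<open>Hom(p, p\<^sup>\<bottom>)\<close> is determined by its value at one generator of the line \<open>p\<close>.  For a
  general matrix \<open>M\<close> the right-hand side \<open>dproj z (M *v z)\<close> is \<open>(1 - P) M P\<close> with \<open>P\<close> the orthogonal
  projection to \<open>p\<close>, that is, the orthogonal projection of \<open>M\<close> to the tangent space.
\<close>

lemma tangent_space_dproj:
  assumes "z \<in> p" "z \<noteq> 0" "p = vec.span {z}"
  shows "A \<in> tangent_space p \<longleftrightarrow> A = dproj z (A *v z)"
proof
  assume A: "A \<in> tangent_space p"
  { fix v
    have p1: "perp z (A *v z) = A *v z"
      using A assms(1) by (simp add: tangent_space_def perp_def)
    have "\<forall>x\<in>p. hprod (perp z v) x = 0"
      using hprod_perp[of z v] by (auto simp: assms(3) vec.span_singleton hprod_simps)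
    then have "A *v perp z v = 0" using A by (simp add: tangent_space_def)
    then have "A *v v = (hprod v z / hprod z z) *s (A *v z)"
      by (simp add: perp_def vec.diff vec.scale)
    then have "A *v v = dproj z (A *v z) *v v"
      by (simp add: dproj_mv p1) }
  then show "A = dproj z (A *v z)" by (blast intro: matrix_eq[THEN iffD2])
next
  assume "A = dproj z (A *v z)"
  moreover have "dproj z u \<in> tangent_space p" for u
    using assms(1) hprod_perp[of z u] by (auto simp: tangent_space_def dproj_mv hprod_simps assms(3) vec.span_singleton)
  ultimately show "A \<in> tangent_space p" by metis
qed

section \<open>Affine charts\<close>

text \<open>The position at which \<open>affine_emb i\<close> places the \<open>j\<close>-th entry of a vector.\<close>

definition slot :: "'n option \<Rightarrow> 'n \<Rightarrow> 'n option" where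
  "slot i j = (if i = Some j then None else Some j)"

lemma bij_slot: "bij_betw (slot i) UNIV (- {i})"
proof (rule bij_betw_imageI)
  show "inj (slot i)" by (auto simp: inj_on_def slot_def split: if_splits)
  have "k \<in> range (slot i)" if "k \<noteq> i" for k
  proof (cases k)
    case None
    with that obtain j where "i = Some j" by (cases i) auto
    with None have "k = slot i j" by (simp add: slot_def)
    then show ?thesis by blast
  next
    case (Some j)
    with that have "k = slot i j" by (simp add: slot_def)
    then show ?thesis by blast
  qed
  then show "range (slot i) = - {i}" by (auto simp: slot_def split: if_splits)
qed

lemma sum_slot: "(\<Sum>k\<in>UNIV. f k) = f i + (\<Sum>j\<in>UNIV. f (slot i j))"
  for i :: "'n::finite option"
proof -
  have "(\<Sum>k\<in>UNIV. f k) = f i + (\<Sum>k\<in>-{i}. f k)"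
    by (metis Compl_eq_Diff_UNIV UNIV_I finite sum.remove)
  then show ?thesis
    using sum.reindex_bij_betw[OF bij_slot[of i], of f] by simp
qed

lemma vec_eq_slot_iff: "v = w \<longleftrightarrow> v $ i = w $ i \<and> (\<forall>j. v $ slot i j = w $ slot i j)"
proof -
  have "k = i \<or> (\<exists>j. k = slot i j)" for k
    using bij_slot[of i] unfolding bij_betw_def by blast
  then show ?thesis unfolding vec_eq_iff by metis
qed

lemma affine_emb_nth [simp]:
  "affine_emb i c w $ i = c"
  "affine_emb i c w $ slot i j = w $ j"
  by (auto simp: affine_emb_def slot_def split: option.split)

lemma hprod_affine_emb: "hprod (affine_emb i c u) (affine_emb i d w) = c * cnj d + hprod u w"
  unfolding hprod_def by (subst sum_slot[of _ i]) simp

lemma affine_emb_linear: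
  "affine_emb i (c + d) (u + v) = affine_emb i c u + affine_emb i d v"
  "affine_emb i (c - d) (u - v) = affine_emb i c u - affine_emb i d v"
  "affine_emb i (a * c) (a *s u) = a *s affine_emb i c u"
  by (simp_all add: vec_eq_slot_iff[of _ _ i])

definition drop_slot :: "'n option \<Rightarrow> complex^('n option) \<Rightarrow> complex^'n" where
  "drop_slot i v = (\<chi> j. v $ slot i j)"

lemma affine_emb_drop_slot: "v $ i = c \<Longrightarrow> affine_emb i c (drop_slot i v) = v"
  by (simp add: vec_eq_slot_iff[of _ _ i] drop_slot_def)

lemma drop_slot_affine_emb: "drop_slot i (affine_emb i c w) = w"
  by (simp add: vec_eq_iff drop_slot_def)

lemma affine_emb_1_nonzero: "affine_emb i 1 w \<noteq> 0"
  using affine_emb_nth(1)[of i 1 w] by force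

lemma chart:
  assumes "p \<in> chart_dom i"
  shows "affine_emb i 1 (chart i p) \<in> p" "p = vec.span {affine_emb i 1 (chart i p)}"
proof -
  obtain y where y: "y \<noteq> 0" "p = vec.span {y}" "\<exists>z\<in>p. z $ i \<noteq> 0"
    using assms by (auto simp: chart_dom_def CP_def)
  then have yi: "y $ i \<noteq> 0" by (auto simp: vec.span_singleton)
  have ex: "affine_emb i 1 (drop_slot i (inverse (y $ i) *s y)) = inverse (y $ i) *s y"
    using yi by (simp add: affine_emb_drop_slot)
  have "\<exists>!w. affine_emb i 1 w \<in> p"
  proof (rule ex1I)
    show "affine_emb i 1 (drop_slot i (inverse (y $ i) *s y)) \<in> p"
      unfolding ex y(2) vec.span_singleton by blast
    fix w assume "affine_emb i 1 w \<in> p"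
    then obtain c where c: "affine_emb i 1 w = c *s y" by (auto simp: y(2) vec.span_singleton)
    then have "1 = c * y $ i" by (metis affine_emb_nth(1) vector_smult_component)
    then have "c = inverse (y $ i)" using yi by (simp add: field_simps)
    then show "w = drop_slot i (inverse (y $ i) *s y)" by (metis c drop_slot_affine_emb)
  qed
  then show 1: "affine_emb i 1 (chart i p) \<in> p" unfolding chart_def by (rule theI')
  then obtain c where c: "affine_emb i 1 (chart i p) = c *s y" by (auto simp: y(2) vec.span_singleton)
  then have "c \<noteq> 0" using affine_emb_1_nonzero by force
  then have "range (\<lambda>k. k *s (c *s y)) = range (\<lambda>k. k *s y)"
    by (auto simp: image_iff) (metis nonzero_eq_divide_eq)
  then have "vec.span {affine_emb i 1 (chart i p)} = vec.span {y}"
    unfolding vec.span_singleton c by simp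
  then show "p = vec.span {affine_emb i 1 (chart i p)}"
    by (rule trans[OF y(2) sym])
qed

text \<open>
  The kernel of \<open>dproj z\<close> is the line of \<open>z\<close>.  It meets the image of \<open>affine_emb i 0\<close> only in \<open>0\<close>
  because \<open>z\<close> has entry \<open>1\<close> in slot \<open>i\<close>.
\<close>

lemma chart_vector_inject: "chart_vector i w u = chart_vector i w v \<longleftrightarrow> u = v"
proof
  assume "chart_vector i w u = chart_vector i w v"
  then have "perp (affine_emb i 1 w) (affine_emb i 0 u - affine_emb i 0 v) = 0"
    by (simp add: chart_vector_def dproj_eq_iff affine_emb_1_nonzero perp_linear)
  then obtain c where c: "affine_emb i 0 u - affine_emb i 0 v = c *s affine_emb i 1 w"
    by (auto simp: perp_def)
  then have "(affine_emb i 0 u - affine_emb i 0 v) $ i = (c *s affine_emb i 1 w) $ i" by simp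
  then have "c = 0" by simp
  then have "affine_emb i 0 u = affine_emb i 0 v" using c by simp
  then show "u = v" by (metis drop_slot_affine_emb)
qed simp

lemma chart_vector_linear:
  "chart_vector i w (u + v) = chart_vector i w u + chart_vector i w v"
  "chart_vector i w (u - v) = chart_vector i w u - chart_vector i w v"
  "chart_vector i w (r *\<^sub>R u) = r *\<^sub>R chart_vector i w u"
  "chart_vector i w (\<i> *s u) = cstruct (chart_vector i w u)"
  using affine_emb_linear[of i 0 0] affine_emb_linear(3)[of i "of_real r" 0] affine_emb_linear(3)[of i \<i> 0]
  by (simp_all add: chart_vector_def dproj_linear[symmetric] scaleR_eq_scale)

text \<open>
  Subtracting a multiple of \<open>z\<close> from \<open>A *v z\<close> does not change the homomorphism it represents and
  makes slot \<open>i\<close> vanish.  In contrast to the description in the definition of \<open>components\<close>, the formula can be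
  differentiated along a curve.
\<close>

lemma components_eq:
  assumes p: "p \<in> chart_dom i" and A: "A \<in> tangent_space p"
  defines "z \<equiv> affine_emb i 1 (chart i p)"
  shows "components i p A = drop_slot i (A *v z - (A *v z) $ i *s z)"
    and "chart_vector i (chart i p) (components i p A) = A"
proof -
  have A': "A = dproj z (A *v z)"
    using tangent_space_dproj[OF chart(1)[OF p] affine_emb_1_nonzero chart(2)[OF p]] A
    by (simp add: z_def)
  have "affine_emb i 0 (drop_slot i (A *v z - (A *v z) $ i *s z)) = A *v z - (A *v z) $ i *s z"
    by (rule affine_emb_drop_slot) (simp add: z_def)
  then have *: "chart_vector i (chart i p) (drop_slot i (A *v z - (A *v z) $ i *s z)) = A"
    using A' unfolding chart_vector_def z_def[symmetric] by (simp add: dproj_linear dproj_self)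
  show **: "components i p A = drop_slot i (A *v z - (A *v z) $ i *s z)"
    unfolding components_def
  proof (rule the_equality[where P = "\<lambda>u. chart_vector i (chart i p) u = A", OF *])
    fix u assume "chart_vector i (chart i p) u = A"
    then show "u = drop_slot i (A *v z - (A *v z) $ i *s z)"
      using * chart_vector_inject by metis
  qed
  show "chart_vector i (chart i p) (components i p A) = A"
    unfolding ** by (rule *)
qed

lemma chart_metric_eq:
  "chart_metric i x u v =
     Re (hprod u v / (1 + hprod x x) - hprod u x * hprod x v / (1 + hprod x x)^2)"
proof -
  define z where "z = affine_emb i 1 x"
  define \<rho> where "\<rho> = 1 + hprod x x"
  have z: "z \<noteq> 0" by (simp add: z_def affine_emb_1_nonzero)
  have "hprod z z = \<rho>" by (simp add: z_def \<rho>_def hprod_affine_emb)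
  moreover have "hprod (affine_emb i 0 u) z = hprod u x" "hprod (affine_emb i 0 v) z = hprod v x"
    by (simp_all add: z_def hprod_affine_emb)
  moreover have "cnj \<rho> = \<rho>" by (simp add: \<rho>_def cnj_hprod)
  ultimately have "hprod (affine_emb i 0 u) (perp z (affine_emb i 0 v)) / hprod z z
      = hprod u v / \<rho> - hprod u x * hprod x v / \<rho>\<^sup>2"
    by (simp add: perp_def hprod_simps hprod_affine_emb cnj_hprod diff_divide_distrib power2_eq_square)
  then show ?thesis
    by (simp add: chart_metric_def chart_vector_def z_def[symmetric] \<rho>_def[symmetric] fubini_study_dproj
        dproj_mv_self[OF z] hprod_perp2)
qed

section \<open>The Levi-Civita connection and the curvature in a chart\<close>

lemmas has_derivative_hprod = bounded_bilinear.FDERIV[OF bounded_bilinear_hprod]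

lemma one_plus_hprod_self_nonzero: "1 + hprod x x \<noteq> 0"
proof -
  have "1 + hprod x x = of_real (1 + (norm x)\<^sup>2)" by (simp add: hprod_self)
  moreover have "1 + (norm x)\<^sup>2 \<noteq> 0" using zero_le_power2[of "norm x"] by linarith
  ultimately show ?thesis by (metis of_real_eq_0_iff)
qed

lemma has_derivative_chart_metric:
  "((\<lambda>x. chart_metric i x v w) has_derivative
    (\<lambda>y. Re (- hprod v w * (hprod y x + hprod x y) / (1 + hprod x x)\<^sup>2
          - (hprod v y * hprod x w + hprod v x * hprod y w) / (1 + hprod x x)\<^sup>2
          + 2 * hprod v x * hprod x w * (hprod y x + hprod x y) / (1 + hprod x x)^3))) (at x)"
proof -
  define R where "R = (\<lambda>x::complex^'a. 1 + hprod x x)"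
  have R: "R x \<noteq> 0" "(R has_derivative (\<lambda>y. hprod y x + hprod x y)) (at x)"
    unfolding R_def by (auto intro!: derivative_eq_intros has_derivative_hprod simp: one_plus_hprod_self_nonzero)
  have "((\<lambda>x. hprod v w / R x - hprod v x * hprod x w / (R x)^2) has_derivative
   (\<lambda>y. - hprod v w * (hprod y x + hprod x y) / (R x)\<^sup>2 - (hprod v y * hprod x w + hprod v x * hprod y w) / (R x)\<^sup>2
          + 2 * hprod v x * hprod x w * (hprod y x + hprod x y) / (R x)^3)) (at x)"
    using R(1)
    by (auto intro!: ext derivative_eq_intros has_derivative_hprod R(2))
      (simp add: hprod_simps divide_simps eval_nat_numeral algebra_simps)
  note this[unfolded R_def]
  from has_derivative_Re[OF this] show ?thesis unfolding chart_metric_eq .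
qed

text \<open>
  This is the Koszul formula for the Fubini-Study metric, in terms of the scalar products of \<open>u\<close>,
  \<open>v\<close>, \<open>w\<close> with each other and with the point \<open>x\<close>: \<open>a\<close>, \<open>b\<close>, \<open>c\<close> stand for \<open>hprod u x\<close>, \<open>hprod v x\<close>, \<open>hprod w x\<close>,
  \<open>p\<close>, \<open>q\<close>, \<open>r\<close> for \<open>hprod u v\<close>, \<open>hprod u w\<close>, \<open>hprod v w\<close>, and \<open>s\<close> for \<open>1 + hprod x x\<close>.
\<close>

lemma hermitian_koszul_identity:
  fixes a b c p q r s :: complex
  assumes "cnj s = s"
  shows "2 * Re (- (a * r + b * q) / s\<^sup>2 + 2 * a * b * cnj c / s^3) =
    Re (- r * (a + cnj a) / s\<^sup>2 - (cnj p * cnj c + b * q) / s^2 + 2 * b * cnj c * (a + cnj a) / s^3)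
  + Re (- q * (b + cnj b) / s\<^sup>2 - (p * cnj c + a * r) / s^2 + 2 * a * cnj c * (b + cnj b) / s^3)
  - Re (- p * (c + cnj c) / s\<^sup>2 - (q * cnj b + a * cnj r) / s^2 + 2 * a * cnj b * (c + cnj c) / s^3)"
proof -
  have s: "s = of_real (Re s)" using assms by (simp add: complex_eq_iff)
  then obtain R where R: "s = of_real R" by blast
  have i: "inverse s ^ n = of_real (inverse R ^ n)" for n by (simp add: R)
  show ?thesis unfolding divide_inverse power_inverse[symmetric] i
   by (simp add: algebra_simps)
qed

text \<open>
  The value is complex bilinear in \<open>u\<close> and \<open>v\<close>, as it must be for a Kaehler metric in holomorphic
  coordinates.
\<close>

lemma christoffel_chart_metric:
  "christoffel (chart_metric i) x u v = - inverse (1 + hprod x x) *s (hprod u x *s v + hprod v x *s u)"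
  (is "_ = ?G")
proof -
  define \<rho> where "\<rho> = 1 + hprod x x"
  have \<rho>: "cnj \<rho> = \<rho>" "\<rho> \<noteq> 0" by (simp_all add: \<rho>_def cnj_hprod one_plus_hprod_self_nonzero)
  have FD: "frechet_derivative (\<lambda>x. chart_metric i x v w) (at x) y = Re (- hprod v w * (hprod y x + hprod x y) / \<rho>\<^sup>2 - (hprod v y * hprod x w + hprod v x * hprod y w) / \<rho>\<^sup>2
          + 2 * hprod v x * hprod x w * (hprod y x + hprod x y) / \<rho>^3)" for v w y
    by (subst frechet_derivative_at[OF has_derivative_chart_metric, symmetric]) (simp add: \<rho>_def)
  have G: "2 * chart_metric i x ?G w =
       frechet_derivative (\<lambda>x. chart_metric i x v w) (at x) u
     + frechet_derivative (\<lambda>x. chart_metric i x u w) (at x) v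
     - frechet_derivative (\<lambda>x. chart_metric i x u v) (at x) w" for w
  proof -
    have "chart_metric i x ?G w = Re (- (hprod u x * hprod v w + hprod v x * hprod u w) / \<rho>\<^sup>2 + 2 * hprod u x * hprod v x * cnj (hprod w x) / \<rho>^3)"
      unfolding chart_metric_eq \<rho>_def[symmetric]
      by (intro arg_cong[where f=Re]) (simp add: hprod_simps cnj_hprod divide_simps \<rho> eval_nat_numeral algebra_simps)
    then show ?thesis
      unfolding FD using hermitian_koszul_identity[OF \<rho>(1), of "hprod u x" "hprod v w" "hprod v x" "hprod u w" "hprod w x" "hprod u v"]
      by (simp only: cnj_hprod)
  qed
  show ?thesis unfolding christoffel_def
  proof (rule the_equality)
    fix y assume y: "\<forall>w. 2 * chart_metric i x y w =
       frechet_derivative (\<lambda>x. chart_metric i x v w) (at x) u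
     + frechet_derivative (\<lambda>x. chart_metric i x u w) (at x) v
     - frechet_derivative (\<lambda>x. chart_metric i x u v) (at x) w"
    then have "chart_metric i x y (y - ?G) = chart_metric i x ?G (y - ?G)"
      using G[of "y - ?G"] spec[OF y, of "y - ?G"] by linarith
    then have "chart_vector i x (y - ?G) \<bullet> chart_vector i x (y - ?G) = 0"
      by (simp only: chart_metric_def fubini_study_inner chart_vector_linear(2) inner_diff_left)
    then have "chart_vector i x y = chart_vector i x ?G" by (simp add: chart_vector_linear)
    then show "y = ?G" by (simp only: chart_vector_inject)
  qed (use G in blast)
qed

text \<open>
  When both arguments lie on the complex line of \<open>u\<close>, so does the value of the Christoffel map; its
  derivative then reduces to that of a scalar function.
\<close>

lemma has_derivative_christoffel_on_line:
  "((\<lambda>x. (c * hprod u x / (1 + hprod x x)) *s u) has_derivative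
    (\<lambda>y. (c * (hprod u y / (1 + hprod x x) - hprod u x * (hprod y x + hprod x y) / (1 + hprod x x)\<^sup>2)) *s u)) (at x)"
proof -
  define R where "R = (\<lambda>x::complex^'a. 1 + hprod x x)"
  have R: "R x \<noteq> 0" "(R has_derivative (\<lambda>y. hprod y x + hprod x y)) (at x)"
    unfolding R_def by (auto intro!: derivative_eq_intros has_derivative_hprod simp: one_plus_hprod_self_nonzero)
  have "((\<lambda>x. c * hprod u x / R x) has_derivative
    (\<lambda>y. c * (hprod u y / R x - hprod u x * (hprod y x + hprod x y) / (R x)\<^sup>2))) (at x)"
    using R(1)
    by (auto intro!: ext derivative_eq_intros has_derivative_hprod R(2)
      simp: hprod_simps divide_simps eval_nat_numeral) (simp add: algebra_simps)
  note this[unfolded R_def]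
  from bounded_linear.has_derivative[OF bounded_bilinear.bounded_linear_left[OF bounded_bilinear_scale] this]
  show ?thesis .
qed

text \<open>
  For \<open>a = \<i>\<close> the factor is \<open>-4 \<i> g(u,u)\<close>, so that \<open>g(R(u,Ju)Ju,u) = 4 g(u,u)\<^sup>2\<close>: the holomorphic
  sectional curvature is 4.  All vectors in the computation are multiples of \<open>u\<close>, which reduces it
  to an identity between scalars.
\<close>

lemma local_curvature_complex_line:
  "local_curvature (chart_metric i) x u (a *s u) u
     = (- 2 * (a - cnj a) * of_real (chart_metric i x u u)) *s u"
proof -
  define \<rho> where "\<rho> = 1 + hprod x x"
  have \<rho>: "cnj \<rho> = \<rho>" "\<rho> \<noteq> 0" by (simp_all add: \<rho>_def cnj_hprod one_plus_hprod_self_nonzero)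
  have C: "christoffel (chart_metric i) x (a *s u) (b *s u) = ((- 2 * a * b) * hprod u x / (1 + hprod x x)) *s u" for a b x
    by (simp add: christoffel_chart_metric vec_eq_iff hprod_simps divide_inverse algebra_simps)
  have C1: "christoffel (chart_metric i) x (a *s u) u = ((- 2 * a) * hprod u x / (1 + hprod x x)) *s u"
     "christoffel (chart_metric i) x u (a *s u) = ((- 2 * a) * hprod u x / (1 + hprod x x)) *s u"
     "christoffel (chart_metric i) x u u = (- 2 * hprod u x / (1 + hprod x x)) *s u" for a x
    using C[of x a 1] C[of x 1 a] C[of x 1 1] by simp_all
  have D: "frechet_derivative (\<lambda>x. (c * hprod u x / (1 + hprod x x)) *s u) (at x) y =
    (c * (hprod u y / \<rho> - hprod u x * (hprod y x + hprod x y) / \<rho>\<^sup>2)) *s u" for c y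
    by (subst frechet_derivative_at[OF has_derivative_christoffel_on_line, symmetric]) (simp add: \<rho>_def)
  define m where "m = hprod u u / \<rho> - hprod u x * hprod x u / \<rho>\<^sup>2"
  have "cnj m = m" by (simp add: m_def cnj_hprod \<rho> mult.commute)
  then have "of_real (Re m) = m" by (simp add: complex_eq_iff)
  then have m: "of_real (chart_metric i x u u) = m"
    unfolding chart_metric_eq \<rho>_def[symmetric] m_def .
  have "local_curvature (chart_metric i) x u (a *s u) u = (- 2 * (a - cnj a) * (hprod u u / \<rho> - hprod u x * hprod x u / \<rho>\<^sup>2)) *s u"
    unfolding local_curvature_def C C1 D unfolding \<rho>_def[symmetric]
    by (simp add: vec_eq_iff hprod_simps divide_simps \<rho> eval_nat_numeral algebra_simps)
  then show ?thesis by (simp only: m m_def)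
qed

section \<open>Covariant differentiation as projected differentiation\<close>

lemma frechet_derivative_within_1:
  assumes "at t within I \<noteq> bot" "(f has_vector_derivative f') (at t within I)"
  shows "frechet_derivative f (at t within I) 1 = f'"
proof -
  have *: "(f has_derivative frechet_derivative f (at t within I)) (at t within I)"
    by (rule iffD1[OF frechet_derivative_works differentiableI_vector[OF assms(2)]])
  have "frechet_derivative f (at t within I) r = r *\<^sub>R frechet_derivative f (at t within I) 1" for r
    using linear_scale[OF has_derivative_linear[OF *], of r 1] by simp
  then have "(f has_vector_derivative frechet_derivative f (at t within I) 1) (at t within I)"
    unfolding has_vector_derivative_def by (intro has_derivative_eq_rhs[OF *] ext)
  then show ?thesis using vector_derivative_unique_within assms by blast
qed

lemma chart_at_dom:
  assumes "p \<in> CP" shows "p \<in> chart_dom (chart_at p)"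
proof -
  obtain z where z: "z \<noteq> 0" "p = vec.span {z}" using assms by (auto simp: CP_def)
  then obtain i where "z $ i \<noteq> 0" by (auto simp: vec_eq_iff)
  then have "p \<in> chart_dom i" using z assms by (auto simp: chart_dom_def intro!: bexI[of _ z] vec.span_base)
  then show ?thesis unfolding chart_at_def by (rule someI)
qed

text \<open>The generator of a line whose entry in the slot of the chosen chart is \<open>1\<close>.\<close>

definition rep :: "(complex^('n::finite option)) set \<Rightarrow> complex^('n option)" where
  "rep p = affine_emb (chart_at p) 1 (chart (chart_at p) p)"

text \<open>
  The orthogonal projection \<open>M \<mapsto> (1 - P) M P\<close> of matrices to \<open>Hom(p, p\<^sup>\<bottom>)\<close>, where \<open>P\<close> is the
  orthogonal projection to \<open>p\<close>.
\<close>

definition tangent_proj ::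
    "(complex^('n::finite option)) set \<Rightarrow> complex^('n option)^('n option) \<Rightarrow> complex^('n option)^('n option)" where
  "tangent_proj p M = dproj (rep p) (M *v rep p)"

lemma rep_nonzero: "rep p \<noteq> 0"
  by (simp add: rep_def affine_emb_1_nonzero)

lemma tangent_proj_linear:
  "tangent_proj p (A + B) = tangent_proj p A + tangent_proj p B"
  "tangent_proj p (r *\<^sub>R A) = r *\<^sub>R tangent_proj p A"
  "tangent_proj p (cstruct A) = cstruct (tangent_proj p A)"
  by (simp_all add: tangent_proj_def matrix_vector_mult_add_rdistrib cstruct_mv dproj_linear
      bounded_bilinear.scaleR_left[OF bounded_bilinear_mv])

lemma tangent_proj_iff:
  assumes "p \<in> CP"
  shows "A \<in> tangent_space p \<longleftrightarrow> tangent_proj p A = A"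
  using tangent_space_dproj[OF chart(1) affine_emb_1_nonzero chart(2)] chart_at_dom[OF assms]
  unfolding tangent_proj_def rep_def by metis

text \<open>
  With \<open>M\<close> the ordinary derivative of the first frame vector of a Frenet curve and \<open>B\<close> the second frame
  vector, the left-hand side is the curvature \<open>k\<^sub>1\<close> and the right-hand side is visibly smooth.
\<close>

lemma tangent_proj_inner:
  assumes "p \<in> CP" "B \<in> tangent_space p"
  shows "tangent_proj p M \<bullet> B = M \<bullet> B"
  using fubini_study_dproj_left[OF rep_nonzero] tangent_proj_iff[OF assms(1)] assms(2)
  unfolding tangent_proj_def fubini_study_inner by metis

lemma smooth_curve_chart:
  assumes "smooth_curve I \<gamma>" "t \<in> I" "\<gamma> t \<in> chart_dom i"
  shows "at t within {t\<in>I. \<gamma> t \<in> chart_dom i} = at t within I"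
    and "\<exists>w'. ((\<lambda>t. chart i (\<gamma> t)) has_vector_derivative w') (at t within I)"
proof -
  let ?U = "{t\<in>I. \<gamma> t \<in> chart_dom i}"
  have "openin (top_of_set I) ?U" using assms(1) by (simp add: smooth_curve_def)
  then obtain T where T: "open T" "?U = I \<inter> T" by (auto simp: openin_open)
  show 1: "at t within ?U = at t within I"
  proof (rule at_within_nhd[of t T])
    show "t \<in> T" using T(2) assms(2,3) by blast
    show "open T" by (rule T(1))
    show "?U \<inter> T - {t} = I \<inter> T - {t}" using T(2) by blast
  qed
  have "smooth_fun_on ?U (\<lambda>t. chart i (\<gamma> t))" using assms(1) by (simp add: smooth_curve_def)
  then obtain F where F: "\<forall>t\<in>?U. F (0::nat) t = chart i (\<gamma> t)"
     "\<forall>m. \<forall>t\<in>?U. (F m has_vector_derivative F (Suc m) t) (at t within ?U)"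
    unfolding smooth_fun_on_def by blast
  have t: "t \<in> ?U" using assms by simp
  have "((\<lambda>t. chart i (\<gamma> t)) has_vector_derivative F 1 t) (at t within ?U)"
    by (rule has_vector_derivative_transform[OF t, of _ "F 0"]) (use F t in auto)
  then show "\<exists>w'. ((\<lambda>t. chart i (\<gamma> t)) has_vector_derivative w') (at t within I)"
    unfolding 1 by blast
qed

text \<open>
  The Levi-Civita connection of projective space is the connection that \<open>Hom(p, p\<^sup>\<bottom>)\<close> inherits as a
  subbundle of the trivial bundle of matrices.  In the chart, differentiating \<open>V = dproj Z v\<close> and
  projecting produces the derivative of \<open>v\<close> and two terms from the derivative of \<open>Z\<close>, which are
  the two terms of the Christoffel map.  The right-hand side involves no chart, so it can be used
  along the whole curve although the chart in the definition of \<open>pullback_nabla\<close> varies from point to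
  point.
\<close>

lemma pullback_nabla_eq:
  fixes \<gamma> :: "real \<Rightarrow> (complex^('n::finite option)) set"
  assumes \<gamma>: "smooth_curve I \<gamma>" and t: "t \<in> I" and nt: "at t within I \<noteq> bot"
    and V: "\<And>s. s \<in> I \<Longrightarrow> V s \<in> tangent_space (\<gamma> s)"
    and V': "(V has_vector_derivative V') (at t within I)"
  shows "pullback_nabla I \<gamma> 1 V t = tangent_proj (\<gamma> t) V'"
proof -
  define i where "i = chart_at (\<gamma> t)"
  define W where "W = (\<lambda>s. chart i (\<gamma> s))"
  define Z where "Z = (\<lambda>s. affine_emb i 1 (W s))"
  define a where "a = (\<lambda>s. V s *v Z s)"
  have "\<gamma> t \<in> CP" using \<gamma> t by (simp add: smooth_curve_def)
  then have ti: "\<gamma> t \<in> chart_dom i" unfolding i_def by (rule chart_at_dom)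
  define U where "U = {t\<in>I. \<gamma> t \<in> chart_dom i}"
  have U: "at t within U = at t within I" "t \<in> U"
    using smooth_curve_chart(1)[OF \<gamma> t ti] t ti by (simp_all add: U_def)
  obtain w' where w': "(W has_vector_derivative w') (at t within I)"
    using smooth_curve_chart(2)[OF \<gamma> t ti] unfolding W_def by blast
  have lin0: "bounded_linear (affine_emb i 0 :: complex^'n \<Rightarrow> _)"
    using affine_emb_linear(1)[of i 0 0] affine_emb_linear(3)[of i _ 0]
    by (auto intro!: linear_conv_bounded_linear[THEN iffD1] linearI simp: scaleR_eq_scale)
  have lind: "bounded_linear (drop_slot i :: _ \<Rightarrow> complex^'n)"
    by (auto intro!: linear_conv_bounded_linear[THEN iffD1] linearI simp: drop_slot_def vec_eq_iff)
  define z' where "z' = affine_emb i 0 w'"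
  have "Z s = affine_emb i 1 0 + affine_emb i 0 (W s)" for s
    unfolding Z_def affine_emb_linear(1)[symmetric] by simp
  then have Z: "Z = (\<lambda>s. affine_emb i 1 0 + affine_emb i 0 (W s))" by (rule ext)
  have z': "(Z has_vector_derivative z') (at t within I)"
    unfolding Z z'_def has_vector_derivative_add_const
    using bounded_linear.has_vector_derivative[OF lin0 w'] has_vector_derivative_add[OF has_vector_derivative_const] by fastforce
  define a' where "a' = V t *v z' + V' *v Z t"
  have a': "(a has_vector_derivative a') (at t within I)"
    unfolding a_def a'_def by (rule bounded_bilinear.has_vector_derivative[OF bounded_bilinear_mv V' z'])
  define c where "c = (\<lambda>s. drop_slot i (a s - (a s $ i) *s Z s))"
  define c' where "c' = drop_slot i (a' - ((a t $ i) *s z' + (a' $ i) *s Z t))"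
  have "(c has_vector_derivative c') (at t within I)"
    unfolding c_def c'_def
    by (intro bounded_linear.has_vector_derivative[OF lind] has_vector_derivative_diff a'
        bounded_bilinear.has_vector_derivative[OF bounded_bilinear_scale] z'
        bounded_linear.has_vector_derivative[OF bounded_linear_vec_nth])
  then have "((\<lambda>s. components i (\<gamma> s) (V s)) has_vector_derivative c') (at t within U)"
    unfolding U(1)[symmetric]
    by (rule has_vector_derivative_transform[OF U(2), rotated])
      (auto simp: U_def c_def a_def Z_def W_def components_eq(1) V)
  then have FD: "frechet_derivative (\<lambda>s. components i (\<gamma> s) (V s)) (at t within I) 1 = c'"
     "frechet_derivative W (at t within I) 1 = w'"
    unfolding U(1) using frechet_derivative_within_1[OF nt] w' by blast+
  have ct: "components i (\<gamma> t) (V t) = c t"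
    using components_eq(1)[OF ti V[OF t]] by (simp add: c_def a_def Z_def W_def)
  define \<rho> where "\<rho> = 1 + hprod (W t) (W t)"
  have \<rho>: "hprod (Z t) (Z t) = \<rho>" "\<rho> \<noteq> 0"
    by (simp_all add: \<rho>_def Z_def hprod_affine_emb one_plus_hprod_self_nonzero)
  have zr: "Z t = rep (\<gamma> t)" by (simp add: Z_def W_def rep_def i_def)
  have Vt: "V t = dproj (Z t) (a t)"
    using V[OF t] tangent_proj_iff[OF \<open>\<gamma> t \<in> CP\<close>] unfolding tangent_proj_def zr a_def by metis
  have at: "perp (Z t) (a t) = a t"
    using dproj_mv_self[of "Z t" "a t"] Vt rep_nonzero unfolding zr a_def by metis
  have az: "hprod (a t) (Z t) = 0" using hprod_perp[of "Z t" "a t"] by (simp add: at)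
  have Vz': "V t *v z' = (hprod z' (Z t) / \<rho>) *s a t"
    by (subst Vt) (simp add: dproj_mv at \<rho>)
  \<comment> \<open>Lifted to homogeneous coordinates, the two Christoffel terms cancel everything but \<open>V' *v Z t\<close>,
    up to multiples of \<open>Z t\<close>: one of them cancels \<open>V t *v z'\<close>, and the other, because \<open>a t\<close> is
    orthogonal to \<open>Z t\<close>, cancels the multiple of \<open>z'\<close> in the lift of \<open>c'\<close>.\<close>
  have e1: "affine_emb i 0 (c t) = a t - (a t $ i) *s Z t"
    unfolding c_def by (rule affine_emb_drop_slot) (simp add: Z_def)
  have e2: "affine_emb i 0 c' = a' - ((a t $ i) *s z' + (a' $ i) *s Z t)"
    unfolding c'_def by (rule affine_emb_drop_slot) (simp add: Z_def z'_def)
  have h1: "hprod w' (W t) = hprod z' (Z t)" by (simp add: z'_def Z_def hprod_affine_emb)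
  have h2: "hprod (c t) (W t) = - (a t $ i) * \<rho>"
  proof -
    have "hprod (c t) (W t) = hprod (affine_emb i 0 (c t)) (Z t)" by (simp add: Z_def hprod_affine_emb)
    also have "\<dots> = - (a t $ i) * \<rho>" unfolding e1 by (simp add: hprod_simps az \<rho>)
    finally show ?thesis .
  qed
  have "affine_emb i 0 (christoffel (chart_metric i) (W t) w' (c t))
      = - inverse \<rho> *s (hprod z' (Z t) *s (a t - (a t $ i) *s Z t) - ((a t $ i) * \<rho>) *s z')"
    unfolding christoffel_chart_metric h1 h2 \<rho>_def[symmetric] e1[symmetric] z'_def
    using affine_emb_linear(1,2)[of i 0 0] affine_emb_linear(3)[of i _ 0] by simp
  then have "affine_emb i 0 (c' + christoffel (chart_metric i) (W t) w' (c t))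
     = V' *v Z t + (hprod z' (Z t) / \<rho> * a t $ i - a' $ i) *s Z t"
    using affine_emb_linear(1)[of i 0 0] \<rho>(2)
    by (simp add: e2 a'_def[unfolded Vz'] vec_eq_iff divide_inverse algebra_simps)
  moreover have zZ: "affine_emb i 1 (W t) = Z t" by (simp add: Z_def)
  ultimately have "chart_vector i (W t) (c' + christoffel (chart_metric i) (W t) w' (c t)) = dproj (Z t) (V' *v Z t)"
    unfolding chart_vector_def zZ by (simp only: dproj_linear dproj_self add_0_right)
  then show ?thesis
    unfolding pullback_nabla_def Let_def i_def[symmetric]
    using FD ct unfolding W_def zr tangent_proj_def by simp
qed

text \<open>
  A matrix multiplied by \<open>\<i>\<close> has components multiplied by \<open>\<i>\<close>, so the curvature on a complex line in the
  chart applies.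
\<close>

lemma curvature_tensor_J:
  assumes p: "p \<in> CP" and A: "A \<in> tangent_space p"
  shows "curvature_tensor p A (r *\<^sub>R cstruct A) A = (- 4 * r * (A \<bullet> A)) *\<^sub>R cstruct A"
proof -
  define i where "i = chart_at p"
  have pi: "p \<in> chart_dom i" unfolding i_def using p by (rule chart_at_dom)
  define x where "x = chart i p"
  define u where "u = components i p A"
  have u: "chart_vector i x u = A" unfolding x_def u_def by (rule components_eq(2)[OF pi A])
  have ru: "chart_vector i x (complex_of_real r *s (\<i> *s u)) = r *\<^sub>R cstruct A" for r
    unfolding scaleR_eq_scale[symmetric] chart_vector_linear u ..
  have "r *\<^sub>R cstruct A \<in> tangent_space p"
    using A tangent_proj_iff[OF p] by (simp add: tangent_proj_linear)
  then have "chart_vector i x (components i p (r *\<^sub>R cstruct A)) = r *\<^sub>R cstruct A"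
    unfolding x_def by (rule components_eq(2)[OF pi])
  then have c: "components i p (r *\<^sub>R cstruct A) = (of_real r * \<i>) *s u"
    using ru chart_vector_inject by (metis vector_smult_assoc)
  have m: "chart_metric i x u u = A \<bullet> A" by (simp add: chart_metric_def u fubini_study_inner)
  have "local_curvature (chart_metric i) x u ((of_real r * \<i>) *s u) u = complex_of_real (- 4 * r * (A \<bullet> A)) *s (\<i> *s u)"
    unfolding local_curvature_complex_line m by (simp add: vec_eq_iff)
  then show ?thesis
    unfolding curvature_tensor_def Let_def i_def[symmetric] x_def[symmetric] u_def[symmetric] c
    by (simp only: ru)
qed

section \<open>Curves whose osculating plane is a complex line\<close>

lemma nontrivial_within_interval:
  fixes I :: "real set"
  assumes "is_interval I" "interior I \<noteq> {}" "t \<in> I"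
  shows "at t within I \<noteq> bot"
proof -
  have "I \<noteq> {x}" for x using assms(2) by (metis interior_singleton)
  then have "t islimpt I"
    using connected_imp_perfect[of I] assms(1,3) is_interval_connected_1 by blast
  then show ?thesis by (simp add: trivial_limit_within)
qed

lemma vector_derivative_eq_0_of_constant:
  assumes "at t within I \<noteq> bot" "t \<in> I" "\<And>x. x \<in> I \<Longrightarrow> h x = c"
    and "(h has_vector_derivative y) (at t within I)"
  shows "y = 0"
proof -
  have "(h has_vector_derivative 0) (at t within I)"
    by (rule has_vector_derivative_transform[OF assms(2) _ has_vector_derivative_const[of c]]) (rule assms(3))
  then show ?thesis using vector_derivative_unique_within[OF assms(1,4)] by blast
qed

lemma unit_vectors_eq_of_inner:
  fixes X Y :: "'a::real_inner"
  assumes "X \<bullet> X = 1" "Y \<bullet> Y = 1" "X \<bullet> Y = s" "s * s = 1"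
  shows "X = s *\<^sub>R Y"
proof -
  have "(X - s *\<^sub>R Y) \<bullet> (X - s *\<^sub>R Y) = 0"
    using assms by (simp add: inner_diff inner_commute[of Y X])
  then show ?thesis by simp
qed

lemma smooth_fun_on_has_vector_derivative:
  assumes "smooth_fun_on I f"
  obtains f' where "smooth_fun_on I f'" "\<And>t. t \<in> I \<Longrightarrow> (f has_vector_derivative f' t) (at t within I)"
proof -
  obtain F where F: "\<forall>t\<in>I. F (0::nat) t = f t"
      "\<forall>m. \<forall>t\<in>I. (F m has_vector_derivative F (Suc m) t) (at t within I)"
    using assms unfolding smooth_fun_on_def by blast
  have "smooth_fun_on I (F 1)"
    unfolding smooth_fun_on_def by (rule exI[of _ "\<lambda>m. F (Suc m)"]) (use F(2) in simp)
  moreover have "(f has_vector_derivative F 1 t) (at t within I)" if "t \<in> I" for t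
    by (rule has_vector_derivative_transform[OF that, of _ "F 0"])
      (use F(1) F(2)[rule_format, OF that, of 0] in auto)
  ultimately show ?thesis by (rule that)
qed

text \<open>
  The torsion is the inner product of the unit vectors \<open>E\<^sub>1\<close> and \<open>J E\<^sub>2\<close>, so its absolute value 1 makes
  them proportional.  The factor is the same along the whole curve because the torsion is
  continuous on an interval and takes only the values \<open>\<plusminus>1\<close>.
\<close>

lemma frenet_frame_complex_line:
  assumes "frenet_curve I \<gamma> d E k" "2 \<le> d"
    and "\<forall>t\<in>I. complex_torsion E 1 2 t = 1 \<or> complex_torsion E 1 2 t = -1"
  obtains s where "s * s = 1" "\<And>t. t \<in> I \<Longrightarrow> E 1 t = s *\<^sub>R cstruct (E 2 t)"
proof -
  note One_nat_def [simp del] One_nat_def [symmetric, simp]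
  note fr = assms(1)[unfolded frenet_curve_def]
  have int: "is_interval I" "interior I \<noteq> {}" using fr by blast+
  have "smooth_fun_on I (E 1)" "smooth_fun_on I (E 2)"
    using fr assms(2) by (auto simp: smooth_field_along_def)
  then have "continuous_on I (E 1)" "continuous_on I (E 2)"
    by (metis smooth_fun_on_has_vector_derivative continuous_on_vector_derivative)+
  then have "continuous_on I (\<lambda>t. E 1 t \<bullet> cstruct (E 2 t))"
    by (intro continuous_on_inner bounded_linear.continuous_on[OF bounded_linear_cstruct])
  moreover have torsion: "E 1 t \<bullet> cstruct (E 2 t) = 1 \<or> E 1 t \<bullet> cstruct (E 2 t) = -1" if "t \<in> I" for t
    using assms(3) that by (simp add: complex_torsion_def fubini_study_inner)
  then have "(\<lambda>t. E 1 t \<bullet> cstruct (E 2 t)) ` I \<subseteq> {1, -1}" by blast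
  then have "finite ((\<lambda>t. E 1 t \<bullet> cstruct (E 2 t)) ` I)" by (rule finite_subset) simp
  ultimately have "(\<lambda>t. E 1 t \<bullet> cstruct (E 2 t)) constant_on I"
    using int(1) by (intro continuous_finite_range_constant) (simp_all add: is_interval_connected_1)
  then obtain s where s: "\<And>t. t \<in> I \<Longrightarrow> E 1 t \<bullet> cstruct (E 2 t) = s" by (auto simp: constant_on_def)
  obtain t where "t \<in> I" using int(2) interior_subset by blast
  then have s2: "s * s = 1" using torsion s by force
  have unit: "E i t \<bullet> E i t = 1" if "t \<in> I" "i \<in> {1..d}" for i t
    using fr that unfolding fubini_study_inner by auto
  have "E 1 t = s *\<^sub>R cstruct (E 2 t)" if "t \<in> I" for t
    by (rule unit_vectors_eq_of_inner[OF _ _ s[OF that] s2])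
      (use unit[OF that] assms(2) in \<open>simp_all add: cstruct_inner\<close>)
  with s2 show ?thesis by (rule that)
qed

locale complex_line_frenet_curve =
  fixes I :: "real set"
    and \<gamma> :: "real \<Rightarrow> (complex^('n::finite option)) set"
    and d :: nat
    and E :: "nat \<Rightarrow> real \<Rightarrow> complex^('n option)^('n option)"
    and k :: "nat \<Rightarrow> real \<Rightarrow> real"
    and s :: real
  assumes frenet: "frenet_curve I \<gamma> d E k"
    and order_ge_2: "2 \<le> d"
    and s_squared: "s * s = 1"
    and E1_eq_JE2: "\<And>t. t \<in> I \<Longrightarrow> E 1 t = s *\<^sub>R cstruct (E 2 t)"
begin

(* The frame vectors are numbered from 1; the simplifier must not turn this index into Suc 0. *)
declare One_nat_def [simp del] One_nat_def [symmetric, simp]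

lemma interval: "is_interval I" "interior I \<noteq> {}"
  and smooth: "smooth_curve I \<gamma>"
  using frenet unfolding frenet_curve_def by blast+

lemma nontrivial: "t \<in> I \<Longrightarrow> at t within I \<noteq> bot"
  using nontrivial_within_interval[OF interval] .

lemma nonempty: "\<exists>t. t \<in> I"
  using interval(2) interior_subset by blast

lemma CP: "t \<in> I \<Longrightarrow> \<gamma> t \<in> CP"
  using smooth by (simp add: smooth_curve_def)

lemma smooth_frame: "smooth_fun_on I (E 1)" "smooth_fun_on I (E 2)"
  and tangent: "t \<in> I \<Longrightarrow> E 1 t \<in> tangent_space (\<gamma> t)" "t \<in> I \<Longrightarrow> E 2 t \<in> tangent_space (\<gamma> t)"
proof -
  have "smooth_field_along I \<gamma> (E 1)" "smooth_field_along I \<gamma> (E 2)"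
    using frenet order_ge_2 unfolding frenet_curve_def by auto
  then show "smooth_fun_on I (E 1)" "smooth_fun_on I (E 2)"
    "t \<in> I \<Longrightarrow> E 1 t \<in> tangent_space (\<gamma> t)" "t \<in> I \<Longrightarrow> E 2 t \<in> tangent_space (\<gamma> t)"
    unfolding smooth_field_along_def by blast+
qed

lemma orthonormal_frame:
  "t \<in> I \<Longrightarrow> i \<in> {1..d} \<Longrightarrow> j \<in> {1..d} \<Longrightarrow> E i t \<bullet> E j t = (if i = j then 1 else 0)"
  using frenet unfolding frenet_curve_def fubini_study_inner by blast

lemma orthonormal:
  assumes "t \<in> I" shows "E 1 t \<bullet> E 1 t = 1" "E 2 t \<bullet> E 2 t = 1" "E 1 t \<bullet> E 2 t = 0" "E 2 t \<bullet> E 1 t = 0"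
  using order_ge_2 by (simp_all add: orthonormal_frame[OF assms])

lemma velocity: "t \<in> I \<Longrightarrow> differential I \<gamma> t 1 = E 1 t"
  using frenet unfolding frenet_curve_def by metis

lemma curvature_pos: "t \<in> I \<Longrightarrow> 1 \<le> i \<Longrightarrow> i < d \<Longrightarrow> k i t > 0"
  using frenet unfolding frenet_curve_def by auto

lemma k1_pos: "t \<in> I \<Longrightarrow> k 1 t > 0"
  using curvature_pos[of t 1] order_ge_2 by simp

lemma frenet_equation:
  "t \<in> I \<Longrightarrow> i \<in> {1..d} \<Longrightarrow> pullback_nabla I \<gamma> 1 (E i) t =
     (if 1 < i then - (k (i - 1) t *\<^sub>R E (i - 1) t) else 0) + (if i < d then k i t *\<^sub>R E (i + 1) t else 0)"
  using frenet unfolding frenet_curve_def by blast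

sublocale J: bounded_linear cstruct
  by (rule bounded_linear_cstruct)

lemma JE2: "t \<in> I \<Longrightarrow> cstruct (E 2 t) = s *\<^sub>R E 1 t"
  using E1_eq_JE2[of t] s_squared by simp

lemma JE1: "t \<in> I \<Longrightarrow> cstruct (E 1 t) = - s *\<^sub>R E 2 t"
  using E1_eq_JE2[of t] by (simp add: J.scaleR cstruct_cstruct)

lemma E2_eq_JE1: "t \<in> I \<Longrightarrow> E 2 t = (- s) *\<^sub>R cstruct (E 1 t)"
  using JE1[of t] s_squared by simp

lemma tangent_proj_E1_derivative:
  assumes t: "t \<in> I" and D: "(E 1 has_vector_derivative D) (at t within I)"
  shows "tangent_proj (\<gamma> t) D = k 1 t *\<^sub>R E 2 t"
  using frenet_equation[OF t, of 1] order_ge_2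
    pullback_nabla_eq[OF smooth t nontrivial[OF t] tangent(1) D]
  by simp

text \<open>
  Multiplication by \<open>\<i>\<close> commutes with differentiation and with the projection to the tangent space, so
  \<open>E\<^sub>2 = - s J E\<^sub>1\<close> can be differentiated covariantly.
\<close>

lemma tangent_proj_E2_derivative:
  assumes t: "t \<in> I" and D: "(E 2 has_vector_derivative D) (at t within I)"
  shows "tangent_proj (\<gamma> t) D = - (k 1 t *\<^sub>R E 1 t)"
proof -
  obtain E1' where E1': "\<And>t. t \<in> I \<Longrightarrow> (E 1 has_vector_derivative E1' t) (at t within I)"
    using smooth_fun_on_has_vector_derivative[OF smooth_frame(1)] by blast
  have "((\<lambda>t. (- s) *\<^sub>R cstruct (E 1 t)) has_vector_derivative (- s) *\<^sub>R cstruct (E1' t)) (at t within I)"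
    by (intro bounded_linear.has_vector_derivative[OF bounded_linear_scaleR_right] J.has_vector_derivative E1' t)
  then have "(E 2 has_vector_derivative (- s) *\<^sub>R cstruct (E1' t)) (at t within I)"
    by (rule has_vector_derivative_transform[OF t, rotated]) (rule E2_eq_JE1)
  then have "D = (- s) *\<^sub>R cstruct (E1' t)"
    using vector_derivative_unique_within[OF nontrivial[OF t] D] by blast
  then have "tangent_proj (\<gamma> t) D = (- s) *\<^sub>R cstruct (k 1 t *\<^sub>R E 2 t)"
    by (simp only: tangent_proj_linear tangent_proj_E1_derivative[OF t E1'[OF t]])
  also have "\<dots> = - ((s * s) * k 1 t) *\<^sub>R E 1 t"
    by (simp add: J.scaleR JE2[OF t] mult_ac)
  finally show ?thesis by (simp add: s_squared)
qed

text \<open>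
  The Frenet equation for \<open>E\<^sub>2\<close> would otherwise contain the nonzero term \<open>k\<^sub>2 E\<^sub>3\<close>.
\<close>

lemma order_eq_2: "d = 2"
proof (rule ccontr)
  assume "d \<noteq> 2"
  then have d: "2 < d" using order_ge_2 by simp
  obtain t where t: "t \<in> I" using nonempty by blast
  obtain E2' where E2': "\<And>t. t \<in> I \<Longrightarrow> (E 2 has_vector_derivative E2' t) (at t within I)"
    using smooth_fun_on_has_vector_derivative[OF smooth_frame(2)] by blast
  have "k 2 t *\<^sub>R E 3 t = 0"
    using frenet_equation[OF t, of 2] d tangent_proj_E2_derivative[OF t E2'[OF t]]
      pullback_nabla_eq[OF smooth t nontrivial[OF t] tangent(2) E2'[OF t]]
    by simp
  moreover have "k 2 t > 0" using curvature_pos[OF t] d by simp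
  ultimately have "E 3 t = 0" by simp
  then show False using orthonormal_frame[OF t, of 3 3] d by simp
qed

text \<open>
  Smoothness of the curvature is a consequence of that of the frame: since \<open>E\<^sub>2\<close> is tangent, the
  projection in \<open>k\<^sub>1 = \<langle>\<nabla>E\<^sub>1, E\<^sub>2\<rangle>\<close> can be dropped, and \<open>k\<^sub>1\<close> is the inner product of two smooth
  matrix-valued functions.
\<close>

lemma k1_derivatives:
  obtains k' k'' where
    "\<And>t. t \<in> I \<Longrightarrow> (k 1 has_vector_derivative k' t) (at t within I)"
    "\<And>t. t \<in> I \<Longrightarrow> (k' has_vector_derivative k'' t) (at t within I)"
proof -
  obtain F1 where F1: "smooth_fun_on I F1" "\<And>t. t \<in> I \<Longrightarrow> (E 1 has_vector_derivative F1 t) (at t within I)"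
    using smooth_fun_on_has_vector_derivative[OF smooth_frame(1)] by blast
  obtain F2 where F2: "smooth_fun_on I F2" "\<And>t. t \<in> I \<Longrightarrow> (F1 has_vector_derivative F2 t) (at t within I)"
    using smooth_fun_on_has_vector_derivative[OF F1(1)] by blast
  obtain F3 where F3: "\<And>t. t \<in> I \<Longrightarrow> (F2 has_vector_derivative F3 t) (at t within I)"
    using smooth_fun_on_has_vector_derivative[OF F2(1)] by blast
  obtain G1 where G1: "smooth_fun_on I G1" "\<And>t. t \<in> I \<Longrightarrow> (E 2 has_vector_derivative G1 t) (at t within I)"
    using smooth_fun_on_has_vector_derivative[OF smooth_frame(2)] by blast
  obtain G2 where G2: "\<And>t. t \<in> I \<Longrightarrow> (G1 has_vector_derivative G2 t) (at t within I)"
    using smooth_fun_on_has_vector_derivative[OF G1(1)] by blast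
  note inner = bounded_bilinear.has_vector_derivative[OF bounded_bilinear_inner]
  have k1: "k 1 t = F1 t \<bullet> E 2 t" if "t \<in> I" for t
  proof -
    have "F1 t \<bullet> E 2 t = tangent_proj (\<gamma> t) (F1 t) \<bullet> E 2 t"
      using tangent_proj_inner[OF CP tangent(2)] that by simp
    then show ?thesis by (simp add: tangent_proj_E1_derivative[OF that F1(2)[OF that]] orthonormal[OF that])
  qed
  have "(k 1 has_vector_derivative F1 t \<bullet> G1 t + F2 t \<bullet> E 2 t) (at t within I)" if t: "t \<in> I" for t
    by (rule has_vector_derivative_transform[OF t k1 inner[OF F2(2)[OF t] G1(2)[OF t]]])
  moreover have "((\<lambda>t. F1 t \<bullet> G1 t + F2 t \<bullet> E 2 t) has_vector_derivative
      (F1 t \<bullet> G2 t + F2 t \<bullet> G1 t) + (F2 t \<bullet> G1 t + F3 t \<bullet> E 2 t)) (at t within I)" if t: "t \<in> I" for t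
    by (rule has_vector_derivative_add[OF inner[OF F2(2)[OF t] G2[OF t]] inner[OF F3[OF t] G1(2)[OF t]]])
  ultimately show ?thesis by (rule that)
qed

lemma pullback_nabla_frame:
  assumes t: "t \<in> I" and V: "\<And>x. x \<in> I \<Longrightarrow> V x = f x *\<^sub>R E 1 x + g x *\<^sub>R E 2 x"
    and f: "(f has_vector_derivative f') (at t within I)"
    and g: "(g has_vector_derivative g') (at t within I)"
  shows "pullback_nabla I \<gamma> 1 V t = (f' - k 1 t * g t) *\<^sub>R E 1 t + (g' + k 1 t * f t) *\<^sub>R E 2 t"
proof -
  obtain E1' E2' where E': "(E 1 has_vector_derivative E1') (at t within I)" "(E 2 has_vector_derivative E2') (at t within I)"
    using smooth_fun_on_has_vector_derivative[OF smooth_frame(1)] smooth_fun_on_has_vector_derivative[OF smooth_frame(2)] t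
    by metis
  have Vt: "V x \<in> tangent_space (\<gamma> x)" if "x \<in> I" for x
    using tangent[OF that] CP[OF that] by (simp add: tangent_proj_iff V[OF that] tangent_proj_linear)
  have "((\<lambda>x. f x *\<^sub>R E 1 x + g x *\<^sub>R E 2 x) has_vector_derivative
     (f t *\<^sub>R E1' + f' *\<^sub>R E 1 t) + (g t *\<^sub>R E2' + g' *\<^sub>R E 2 t)) (at t within I)"
    by (intro has_vector_derivative_add bounded_bilinear.has_vector_derivative[OF bounded_bilinear_scaleR] f g E')
  then have "(V has_vector_derivative
     (f t *\<^sub>R E1' + f' *\<^sub>R E 1 t) + (g t *\<^sub>R E2' + g' *\<^sub>R E 2 t)) (at t within I)"
    by (rule has_vector_derivative_transform[OF t, rotated]) (rule V)
  then have "pullback_nabla I \<gamma> 1 V t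
      = tangent_proj (\<gamma> t) ((f t *\<^sub>R E1' + f' *\<^sub>R E 1 t) + (g t *\<^sub>R E2' + g' *\<^sub>R E 2 t))"
    by (intro pullback_nabla_eq[OF smooth t nontrivial[OF t]] Vt)
  moreover have "tangent_proj (\<gamma> t) (E 1 t) = E 1 t" "tangent_proj (\<gamma> t) (E 2 t) = E 2 t"
    using tangent[OF t] tangent_proj_iff[OF CP[OF t]] by blast+
  ultimately show ?thesis
    by (simp add: tangent_proj_linear tangent_proj_E1_derivative[OF t E'(1)]
        tangent_proj_E2_derivative[OF t E'(2)] algebra_simps)
qed

lemma tension_field_frame:
  assumes "t \<in> I" shows "tension_field I \<gamma> t = k 1 t *\<^sub>R E 2 t"
  using pullback_nabla_frame[OF assms, of "\<lambda>y. differential I \<gamma> y 1" "\<lambda>_. 1" "\<lambda>_. 0" 0 0]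
  by (simp add: tension_field_def velocity)

lemma bitension_field_frame:
  assumes k': "\<And>t. t \<in> I \<Longrightarrow> (k 1 has_vector_derivative k' t) (at t within I)"
    and k'': "\<And>t. t \<in> I \<Longrightarrow> (k' has_vector_derivative k'' t) (at t within I)"
    and t: "t \<in> I"
  shows "bitension_field I \<gamma> t
    = (- 3 * k 1 t * k' t) *\<^sub>R E 1 t + (k'' t - k 1 t ^ 3 + 4 * k 1 t) *\<^sub>R E 2 t"
proof -
  have nabla: "pullback_nabla I \<gamma> 1 (tension_field I \<gamma>) t = (- (k 1 t)\<^sup>2) *\<^sub>R E 1 t + k' t *\<^sub>R E 2 t"
    if "t \<in> I" for t
    using pullback_nabla_frame[OF that, of "tension_field I \<gamma>" "\<lambda>_. 0" "k 1" 0 "k' t"] k'[OF that]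
    by (simp add: tension_field_frame power2_eq_square)
  have "((\<lambda>t. - (k 1 t)\<^sup>2) has_vector_derivative - (2 * k 1 t * k' t)) (at t within I)"
    using k'[OF t] unfolding has_real_derivative_iff_has_vector_derivative[symmetric]
    by (auto intro!: derivative_eq_intros)
  then have "pullback_nabla I \<gamma> 1 (pullback_nabla I \<gamma> 1 (tension_field I \<gamma>)) t
      = (- (2 * k 1 t * k' t) - k 1 t * k' t) *\<^sub>R E 1 t + (k'' t + k 1 t * - (k 1 t)\<^sup>2) *\<^sub>R E 2 t"
    by (intro pullback_nabla_frame[OF t nabla _ k''[OF t]])
  moreover have "- (2 * k 1 t * k' t) - k 1 t * k' t = - 3 * k 1 t * k' t" by simp
  moreover have "k'' t + k 1 t * - (k 1 t)\<^sup>2 = k'' t - k 1 t ^ 3"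
    by (simp add: power2_eq_square power3_eq_cube)
  moreover
  have "tension_field I \<gamma> t = (- s * k 1 t) *\<^sub>R cstruct (E 1 t)"
    using tension_field_frame[OF t] E2_eq_JE1[OF t] by (metis mult.commute scaleR_scaleR)
  then have "curvature_tensor (\<gamma> t) (differential I \<gamma> t 1) (tension_field I \<gamma> t) (differential I \<gamma> t 1)
      = (- 4 * k 1 t) *\<^sub>R E 2 t"
    using curvature_tensor_J[OF CP[OF t] tangent(1)[OF t], of "- s * k 1 t"] s_squared
    by (simp add: velocity[OF t] orthonormal[OF t] JE1[OF t] mult.assoc)
  ultimately show ?thesis
    by (simp add: bitension_field_def rough_laplacian_def algebra_simps)
qed

lemma frame_combination_eq_0_iff:
  assumes "t \<in> I" shows "a *\<^sub>R E 1 t + b *\<^sub>R E 2 t = 0 \<longleftrightarrow> a = 0 \<and> b = 0"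
proof
  assume z: "a *\<^sub>R E 1 t + b *\<^sub>R E 2 t = 0"
  have "(a *\<^sub>R E 1 t + b *\<^sub>R E 2 t) \<bullet> E 1 t = 0" "(a *\<^sub>R E 1 t + b *\<^sub>R E 2 t) \<bullet> E 2 t = 0"
    unfolding z by simp_all
  then show "a = 0 \<and> b = 0"
    using orthonormal[OF assms] by (simp add: inner_add_left)
qed simp

text \<open>
  Because \<open>k\<^sub>1 > 0\<close>, the \<open>E\<^sub>1\<close>-component of the bitension field forces \<open>k\<^sub>1\<close> to be constant; the other
  component then reads \<open>k\<^sub>1 (4 - k\<^sub>1\<^sup>2) = 0\<close>.
\<close>

lemma biharmonic_iff: "biharmonic_map I \<gamma> \<longleftrightarrow> (\<forall>t\<in>I. k 1 t = 2)"
proof -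
  obtain k' k'' where k': "\<And>t. t \<in> I \<Longrightarrow> (k 1 has_vector_derivative k' t) (at t within I)"
    and k'': "\<And>t. t \<in> I \<Longrightarrow> (k' has_vector_derivative k'' t) (at t within I)"
    using k1_derivatives by blast
  have bitension_0: "bitension_field I \<gamma> t = 0 \<longleftrightarrow> k' t = 0 \<and> k'' t - k 1 t ^ 3 + 4 * k 1 t = 0"
    if t: "t \<in> I" for t
  proof -
    have "bitension_field I \<gamma> t
        = (- 3 * k 1 t * k' t) *\<^sub>R E 1 t + (k'' t - k 1 t ^ 3 + 4 * k 1 t) *\<^sub>R E 2 t"
      by (rule bitension_field_frame[OF _ _ t]) (fact k' k'')+
    then have "bitension_field I \<gamma> t = 0
        \<longleftrightarrow> - 3 * k 1 t * k' t = 0 \<and> k'' t - k 1 t ^ 3 + 4 * k 1 t = 0"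
      by (simp only: frame_combination_eq_0_iff[OF t])
    then show ?thesis using k1_pos[OF t] by simp
  qed
  show ?thesis
  proof
    assume "biharmonic_map I \<gamma>"
    then have *: "k' t = 0" "k'' t - k 1 t ^ 3 + 4 * k 1 t = 0" if "t \<in> I" for t
      using that bitension_0 by (auto simp: biharmonic_map_def)
    show "\<forall>t\<in>I. k 1 t = 2"
    proof
      fix t assume t: "t \<in> I"
      have "k'' t = 0"
        using vector_derivative_eq_0_of_constant[OF nontrivial[OF t] t *(1) k''[OF t]] by simp
      then have "k 1 t * ((k 1 t)\<^sup>2 - 2\<^sup>2) = 0"
        using *(2)[OF t] by (simp add: power2_eq_square power3_eq_cube algebra_simps)
      then have "(k 1 t)\<^sup>2 = 2\<^sup>2" using k1_pos[OF t] by simp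
      then have "k 1 t = 2 \<or> k 1 t = - 2" by (rule power2_eq_iff[THEN iffD1])
      then show "k 1 t = 2" using k1_pos[OF t] by linarith
    qed
  next
    assume k2: "\<forall>t\<in>I. k 1 t = 2"
    have k'0: "k' t = 0" if "t \<in> I" for t
      using vector_derivative_eq_0_of_constant[OF nontrivial[OF that] that _ k'[OF that], of 2] k2 by blast
    have "k'' t = 0" if "t \<in> I" for t
      using vector_derivative_eq_0_of_constant[OF nontrivial[OF that] that _ k''[OF that], of 0] k'0 by blast
    then show "biharmonic_map I \<gamma>" using k'0 k2 bitension_0 by (simp add: biharmonic_map_def)
  qed
qed

lemma not_harmonic: "\<not> harmonic_map I \<gamma>"
proof -
  obtain t where t: "t \<in> I" using nonempty by blast
  then have "tension_field I \<gamma> t \<noteq> 0"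
    using frame_combination_eq_0_iff[OF t, of 0 "k 1 t"] k1_pos[OF t] tension_field_frame[OF t] by simp
  then show ?thesis using t by (auto simp: harmonic_map_def)
qed

lemma circle_if:
  assumes "\<forall>t\<in>I. k 1 t = 2" shows "circle I \<gamma> E k"
proof -
  have "\<forall>i\<in>{1..<2}. \<exists>c>0. \<forall>t\<in>I. k i t = c"
    using assms by (auto intro!: exI[of _ 2] simp: less_2_cases_iff)
  then show ?thesis using frenet order_eq_2 by (simp add: circle_def helix_def)
qed

end

theorem proposition5p1:
  fixes I :: "real set"
    and \<gamma> :: "real \<Rightarrow> (complex^('n::finite option)) set"
    and d :: nat
    and E :: "nat \<Rightarrow> real \<Rightarrow> complex^('n option)^('n option)"
    and k :: "nat \<Rightarrow> real \<Rightarrow> real"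
  assumes "frenet_curve I \<gamma> d E k"
    and "2 \<le> d"
    and "\<forall>t\<in>I. complex_torsion E 1 2 t = 1 \<or> complex_torsion E 1 2 t = -1"
  shows "proper_biharmonic_map I \<gamma> \<longleftrightarrow> circle I \<gamma> E k \<and> (\<forall>t\<in>I. k 1 t = 2)"
proof -
  obtain s where "s * s = 1" "\<And>t. t \<in> I \<Longrightarrow> E 1 t = s *\<^sub>R cstruct (E 2 t)"
    using frenet_frame_complex_line[OF assms] by blast
  with assms(1,2) interpret complex_line_frenet_curve I \<gamma> d E k s
    by unfold_locales
  show ?thesis
    using biharmonic_iff not_harmonic circle_if by (auto simp: proper_biharmonic_map_def)
qed

end
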